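(* Let $\rho=\rho_n\in[0,1]$ and let $\epsilon=\epsilon_n\in(0,1)$ with $\epsilon n/\log n\to+\infty$ as $n\to\infty$. Then $$R(\rho,\epsilon,n)=O\Big(\frac{\rho}{n^2}+\max\Big\{\rho,\frac{\log n}{n}\Big\}\frac{\log n}{n^3\epsilon^2}\Big).$$
   Context: $\mathcal G_n$ is the set of simple undirected graphs on $[n]$, and $G_{n,p}$ is the Erdős–Rényi random graph on $[n]$ in which each of the $\binom n2$ possible edges is present independently with probability $p$. Rewiring a vertex means inserting or removing an arbitrary set of edges adjacent to it; $d_v(G_1,G_2)$ is the minimum number of vertices of $G_1$ that need to be rewired to obtain $G_2$. A randomized algorithm $\mathcal A$ on $\mathcal G_n$ is $\epsilon$-node-DP if $\mathbb P(\mathcal A(G_1)\in S)\le e^{\epsilon d_v(G_1,G_2)}\mathbb P(\mathcal A(G_2)\in S)$ for all $G_1,G_2\in\mathcal G_n$ and all measurable $S$. The rate is $$R(\rho,\epsilon,n)=\min_{\mathcal A\ \epsilon\text{-node-DP}}\ \max_{p\in[0,\rho]}\ \mathbb E_{G\sim G_{n,p}}\big[(\mathcal A(G)-p)^2\big],$$ where $\mathcal A$ ranges over real-valued $\epsilon$-node-DP algorithms on $\mathcal G_n$ (which may depend on $n,\rho,\epsilon$), the expectation is also over the randomness of $\mathcal A$, and min/max are understood as inf/sup. *)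

theory Defs
  imports "HOL-Probability.Probability"
begin

text \<open>Simple undirected graphs on \<open>[n] = {1..n}\<close>, represented by their edge sets.\<close>

definition edges :: "nat \<Rightarrow> nat set set" where
  "edges n = {e. e \<subseteq> {1..n} \<and> card e = 2}"

definition graphs :: "nat \<Rightarrow> nat set set set" where
  "graphs n = Pow (edges n)"

definition erdos_renyi :: "nat \<Rightarrow> real \<Rightarrow> nat set set pmf" where
  "erdos_renyi n p =
     map_pmf (\<lambda>f. {e \<in> edges n. f e}) (Pi_pmf (edges n) False (\<lambda>_. bernoulli_pmf p))"

text \<open>\<open>rewiring n S G H\<close>: one can get from \<open>G\<close> to \<open>H\<close> by rewiring, one after another, exactly the
  vertices in \<open>S\<close>; rewiring \<open>v\<close> changes only edges that contain \<open>v\<close>.\<close>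

inductive rewiring :: "nat \<Rightarrow> nat set \<Rightarrow> nat set set \<Rightarrow> nat set set \<Rightarrow> bool" for n where
  none: "G \<in> graphs n \<Longrightarrow> rewiring n {} G G"
| rewire: "rewiring n S G H \<Longrightarrow> v \<in> {1..n} \<Longrightarrow> H' \<in> graphs n \<Longrightarrow>
    (\<forall>e \<in> (H - H') \<union> (H' - H). v \<in> e) \<Longrightarrow> rewiring n (insert v S) G H'"

definition node_dist :: "nat \<Rightarrow> nat set set \<Rightarrow> nat set set \<Rightarrow> nat" where
  "node_dist n G H = (LEAST k. \<exists>S. card S = k \<and> rewiring n S G H)"

text \<open>A real-valued randomized algorithm on \<open>graphs n\<close> is given by its output distribution on each
  graph, an arbitrary Borel probability measure on the reals. Values outside \<open>graphs n\<close> are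
  irrelevant.\<close>

definition node_dp :: "nat \<Rightarrow> real \<Rightarrow> (nat set set \<Rightarrow> real measure) \<Rightarrow> bool" where
  "node_dp n \<epsilon> A \<longleftrightarrow>
     (\<forall>G \<in> graphs n. prob_space (A G) \<and> sets (A G) = sets borel) \<and>
     (\<forall>G \<in> graphs n. \<forall>H \<in> graphs n. \<forall>S \<in> sets borel.
        measure (A G) S \<le> exp (\<epsilon> * real (node_dist n G H)) * measure (A H) S)"

text \<open>The risk takes values in \<^typ>\<open>ennreal\<close>, so that an algorithm with infinite mean squared error
  has risk \<open>\<infinity>\<close>.\<close>

definition mse :: "nat \<Rightarrow> (nat set set \<Rightarrow> real measure) \<Rightarrow> real \<Rightarrow> ennreal" where
  "mse n A p =
     (\<integral>\<^sup>+ G. (\<integral>\<^sup>+ x. ennreal ((x - p)\<^sup>2) \<partial>A G) \<partial>measure_pmf (erdos_renyi n p))"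

definition rate :: "real \<Rightarrow> real \<Rightarrow> nat \<Rightarrow> ennreal" where
  "rate \<rho> \<epsilon> n = (INF A \<in> {A. node_dp n \<epsilon> A}. SUP p \<in> {0..\<rho>}. mse n A p)"

end

theory Submission
  imports Defs
begin

text \<open>
  Call \<open>G\<close> homogeneous if, for every vertex set \<open>S\<close>, the number of edges of \<open>G - S\<close> is what
  the edge density \<open>d(G)\<close> predicts, up to an error \<open>L |S|\<close>. Two homogeneous graphs that agree off
  a set \<open>S\<close> with \<open>|S| \<le> n/2\<close> have densities that differ by at most \<open>\<eta> |S|\<close>, where
  \<open>\<eta> = 32 L / n\<^sup>2\<close>. Hence the score \<open>u(G, q)\<close>, the minimum of \<open>|S| + |q - d(H)| / \<eta>\<close> over all
  homogeneous \<open>H\<close> that agree with \<open>G\<close> off \<open>S\<close>, is 1-Lipschitz in \<open>G\<close> for the node distance on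
  all graphs, and on homogeneous \<open>G\<close> it lies between \<open>min (|q - d(G)| / \<eta>) (n/2)\<close> and
  \<open>|q - d(G)| / \<eta>\<close>. The exponential mechanism with density proportional to
  \<open>exp (-\<epsilon> u(G, q) / 2)\<close> on \<open>[0, 2]\<close> is therefore \<open>\<epsilon>\<close>-node-DP, and on homogeneous graphs it
  estimates \<open>d(G)\<close> with mean squared error of order \<open>(\<eta>/\<epsilon>)\<^sup>2\<close>; the cap \<open>n/2\<close> contributes only
  \<open>exp (-\<epsilon> n / 4)\<close>, which is negligible because \<open>\<epsilon> n / log n\<close> tends to infinity. By a Chernoff bound and
  a union bound over \<open>S\<close>, the random graph is homogeneous with probability \<open>1 - O(n\<^sup>-\<^sup>5)\<close> when \<open>L\<close>
  is of order \<open>sqrt (n \<sigma> log n)\<close> with \<open>\<sigma> = max \<rho> (log n / n)\<close>. The term \<open>\<rho>/n\<^sup>2\<close> is the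
  variance of \<open>d(G)\<close>.
\<close>

definition avoiding :: "nat set \<Rightarrow> nat set set \<Rightarrow> nat set set" where
  "avoiding S G = {e \<in> G. e \<inter> S = {}}"

definition touching :: "nat set \<Rightarrow> nat set set \<Rightarrow> nat set set" where
  "touching S G = {e \<in> G. e \<inter> S \<noteq> {}}"

definition edge_density :: "nat \<Rightarrow> nat set set \<Rightarrow> real" where
  "edge_density n G = real (card G) / real (card (edges n))"

text \<open>The reference density is that of \<open>G\<close> itself rather than \<open>p\<close>,
  so a mechanism that does not know \<open>p\<close> can work with the condition.\<close>

definition homogeneous :: "nat \<Rightarrow> real \<Rightarrow> nat set set set" where
  "homogeneous n L = {G \<in> graphs n. \<forall>S \<subseteq> {1..n}.
     \<bar>real (card (avoiding S G)) - edge_density n G * real (card (avoiding S (edges n)))\<bar>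
       \<le> L * real (card S)}"

text \<open>A pair \<open>(S, H)\<close> is a way to reach a homogeneous graph \<open>H\<close> from \<open>G\<close> by rewiring \<open>S\<close>.\<close>

definition repairs :: "nat \<Rightarrow> real \<Rightarrow> nat set set \<Rightarrow> (nat set \<times> nat set set) set" where
  "repairs n L G = {(S, H). S \<subseteq> {1..n} \<and> H \<in> homogeneous n L \<and> avoiding S G = avoiding S H}"

text \<open>An infimal convolution in the style of McShane's Lipschitz extension, from homogeneous
  graphs to all graphs.\<close>

definition score :: "nat \<Rightarrow> real \<Rightarrow> real \<Rightarrow> nat set set \<Rightarrow> real \<Rightarrow> real" where
  "score n L \<eta> G q =
     Min ((\<lambda>(S, H). real (card S) + \<bar>q - edge_density n H\<bar> / \<eta>) ` repairs n L G)"

section \<open>The score\<close>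

lemma finite_edges [simp]: "finite (edges n)"
  by (rule finite_subset[of _ "Pow {1..n}"]) (auto simp: edges_def)

lemma card_edges: "card (edges n) = n choose 2"
  using n_subsets[of "{1..n}" 2] by (simp add: edges_def)

lemma choose_two_real: "real (m choose 2) = real m * (real m - 1) / 2"
proof -
  have "2 * (m choose 2) = m * (m - 1)"
    unfolding choose_two by (rule dvd_mult_div_cancel) (cases m; simp)
  then have "2 * real (m choose 2) = real m * real (m - 1)" by (metis of_nat_mult of_nat_numeral)
  then show ?thesis by (cases m) auto
qed

lemma card_edges_ge:
  assumes "n \<ge> 2"
  shows "real n ^ 2 / 4 \<le> real (card (edges n))"
  using assms mult_mono[of 2 "real n" "real n" "real n"]
  by (simp add: card_edges choose_two_real power2_eq_square field_simps)

lemma finite_graphs [simp]: "finite (graphs n)"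
  by (simp add: graphs_def)

lemma finite_graph: "G \<in> graphs n \<Longrightarrow> finite G"
  by (auto simp: graphs_def intro: finite_subset)

lemma card_graph_le: "G \<in> graphs n \<Longrightarrow> card G \<le> card (edges n)"
  by (auto simp: graphs_def intro: card_mono)

lemma edge_density_bounds:
  assumes "G \<in> graphs n"
  shows "0 \<le> edge_density n G" "edge_density n G \<le> 1"
  using card_graph_le[OF assms] by (auto simp: edge_density_def divide_le_eq)

lemma card_avoiding_edges:
  assumes "S \<subseteq> {1..n}"
  shows "card (avoiding S (edges n)) = (n - card S) choose 2"
proof -
  have "avoiding S (edges n) = {e. e \<subseteq> {1..n} - S \<and> card e = 2}"
    by (auto simp: avoiding_def edges_def)
  moreover have "card ({1..n} - S) = n - card S"
    using assms by (simp add: card_Diff_subset finite_subset)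
  ultimately show ?thesis
    using n_subsets[of "{1..n} - S" 2] by simp
qed

lemma card_touching_edges_le:
  assumes "S \<subseteq> {1..n}"
  shows "card (touching S (edges n)) \<le> card S * n"
proof -
  have fin: "finite S" using assms finite_subset by blast
  have "touching S (edges n) \<subseteq> (\<lambda>(a, b). {a, b}) ` (S \<times> {1..n})"
  proof
    fix e assume e: "e \<in> touching S (edges n)"
    then obtain a where a: "a \<in> e" "a \<in> S" by (auto simp: touching_def)
    from e have "card e = 2" "e \<subseteq> {1..n}" by (auto simp: touching_def edges_def)
    then obtain x y where xy: "e = {x, y}" by (auto simp: card_2_iff)
    then obtain b where "e = {a, b}" using a by auto
    with \<open>e \<subseteq> {1..n}\<close> a show "e \<in> (\<lambda>(a, b). {a, b}) ` (S \<times> {1..n})" by force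
  qed
  then have "card (touching S (edges n)) \<le> card ((\<lambda>(a, b). {a, b}) ` (S \<times> {1..n}))"
    using fin by (intro card_mono) auto
  also have "\<dots> \<le> card (S \<times> {1..n})" using fin by (intro card_image_le) auto
  finally show ?thesis by (simp add: card_cartesian_product)
qed

lemma card_avoiding_touching:
  "finite G \<Longrightarrow> card (avoiding S G) + card (touching S G) = card G"
  by (subst card_Un_disjoint[symmetric])
     (auto simp: avoiding_def touching_def intro!: arg_cong[of _ _ card])

lemma avoiding_Un: "avoiding (S \<union> T) G = avoiding T (avoiding S G)"
  by (auto simp: avoiding_def)

section \<open>Rewiring and the node distance\<close>

lemma rewiringD:
  assumes "rewiring n S G H"
  shows "S \<subseteq> {1..n}" "avoiding S G = avoiding S H"
proof -
  have "S \<subseteq> {1..n} \<and> avoiding S G = avoiding S H"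
    using assms
  proof (induction rule: rewiring.induct)
    case (rewire S G H v H')
    \<comment> \<open>Edges that miss \<open>v\<close> survive the rewiring of \<open>v\<close>. The
      rest is that \<open>v\<close> and \<open>S\<close> can be removed in either order.\<close>
    have "e \<in> H \<longleftrightarrow> e \<in> H'" if "v \<notin> e" for e using rewire.hyps(4) that by blast
    then have "avoiding {v} H = avoiding {v} H'" by (auto simp: avoiding_def)
    have "avoiding (insert v S) G = avoiding {v} (avoiding S H)"
      using rewire.IH avoiding_Un[of S "{v}"] by simp
    also have "\<dots> = avoiding S (avoiding {v} H')"
      using avoiding_Un[of S "{v}" H] avoiding_Un[of "{v}" S H] \<open>avoiding {v} H = _\<close> by simp
    also have "\<dots> = avoiding (insert v S) H'"
      using avoiding_Un[of "{v}" S H'] by simp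
    finally show ?case using rewire.IH rewire.hyps(2) by simp
  qed simp
  then show "S \<subseteq> {1..n}" "avoiding S G = avoiding S H" by auto
qed

text \<open>Ensures that the \<open>LEAST\<close> in \<open>node_dist\<close> ranges over a nonempty
  set, so that a minimal rewiring exists.\<close>

lemma rewiring_all:
  assumes G: "G \<in> graphs n" and H: "H \<in> graphs n"
  shows "rewiring n {1..n} G H"
proof -
  \<comment> \<open>Once the vertices of \<open>S\<close> are rewired, the edges touching
    \<open>S\<close> are those of \<open>H\<close> and the others are still those of
    \<open>G\<close>.\<close>
  have "rewiring n S G (avoiding S G \<union> touching S H)" if "finite S" "S \<subseteq> {1..n}" for S
    using that
  proof (induction S rule: finite_induct)
    case empty
    have "avoiding {} G \<union> touching {} H = G" by (auto simp: avoiding_def touching_def)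
    then show ?case using rewiring.none[OF G] by simp
  next
    case (insert v S)
    show ?case
    proof (rule rewiring.rewire[where H = "avoiding S G \<union> touching S H"])
      show "avoiding (insert v S) G \<union> touching (insert v S) H \<in> graphs n"
        using G H by (auto simp: graphs_def avoiding_def touching_def)
    qed (use insert in \<open>auto simp: avoiding_def touching_def\<close>)
  qed
  from this[of "{1..n}"] have "rewiring n {1..n} G (avoiding {1..n} G \<union> touching {1..n} H)"
    by simp
  \<comment> \<open>Every edge meets the full vertex set, so the last intermediate graph is
    \<open>H\<close>.\<close>
  moreover have "e \<inter> {1..n} \<noteq> {}" if "e \<in> edges n" for e
    using that by (auto simp: edges_def Int_absorb2)
  then have "avoiding {1..n} G \<union> touching {1..n} H = H"
    using G H unfolding graphs_def avoiding_def touching_def by blast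
  ultimately show ?thesis by simp
qed

lemma node_dist_witness:
  assumes "G \<in> graphs n" "H \<in> graphs n"
  obtains S where "card S = node_dist n G H" "S \<subseteq> {1..n}" "avoiding S G = avoiding S H"
proof -
  have "\<exists>S. card S = node_dist n G H \<and> rewiring n S G H"
    unfolding node_dist_def
    by (rule LeastI_ex) (use rewiring_all[OF assms] in blast)
  then show ?thesis using that rewiringD by blast
qed

section \<open>Bounds for the score\<close>

lemma empty_homogeneous: "0 \<le> L \<Longrightarrow> {} \<in> homogeneous n L"
  by (auto simp: homogeneous_def graphs_def avoiding_def edge_density_def)

lemma homogeneous_graph: "G \<in> homogeneous n L \<Longrightarrow> G \<in> graphs n"
  by (simp add: homogeneous_def)

lemma finite_repairs [simp]: "finite (repairs n L G)"
  by (rule finite_subset[of _ "Pow {1..n} \<times> graphs n"]) (auto simp: repairs_def homogeneous_def)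

text \<open>Rewiring all vertices reaches the empty graph, which is homogeneous. Hence the
  \<open>Min\<close> in \<open>score\<close> is a genuine minimum on every graph.\<close>

lemma repairs_nonempty:
  assumes "0 \<le> L" "G \<in> graphs n"
  shows "repairs n L G \<noteq> {}"
proof -
  have "avoiding {1..n} G = avoiding {1..n} {}"
    using assms by (auto simp: avoiding_def graphs_def edges_def Int_absorb2)
  then show ?thesis using empty_homogeneous[OF assms(1)] by (force simp: repairs_def)
qed

lemma score_attained:
  assumes "0 \<le> L" "G \<in> graphs n"
  obtains S H where "(S, H) \<in> repairs n L G"
    "score n L \<eta> G q = real (card S) + \<bar>q - edge_density n H\<bar> / \<eta>"
proof -
  have "score n L \<eta> G q \<in> (\<lambda>(S, H). real (card S) + \<bar>q - edge_density n H\<bar> / \<eta>) ` repairs n L G"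
    unfolding score_def using repairs_nonempty[OF assms] by (intro Min_in) auto
  then show ?thesis using that by auto
qed

lemma score_le:
  "(S, H) \<in> repairs n L G \<Longrightarrow> score n L \<eta> G q \<le> real (card S) + \<bar>q - edge_density n H\<bar> / \<eta>"
  unfolding score_def by (intro Min_le) auto

lemma score_nonneg:
  assumes "0 \<le> L" "0 < \<eta>" "G \<in> graphs n"
  shows "0 \<le> score n L \<eta> G q"
  using score_attained[OF assms(1,3)] assms(2)
  by (metis add_nonneg_nonneg abs_ge_zero divide_nonneg_pos of_nat_0_le_iff)

lemma borel_measurable_score [measurable]: "score n L \<eta> G \<in> borel_measurable borel"
  unfolding score_def[abs_def]
  by (cases "repairs n L G = {}") (auto simp: case_prod_beta)

text \<open>If \<open>T\<close> repairs \<open>H\<close>, then \<open>S \<union> T\<close> repairs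
  \<open>G\<close> with the same target, at an extra cost of at most \<open>card S\<close>.\<close>

lemma score_le_add_card:
  assumes L: "0 \<le> L" and H: "H \<in> graphs n"
    and S: "S \<subseteq> {1..n}" "avoiding S G = avoiding S H"
  shows "score n L \<eta> G q \<le> score n L \<eta> H q + real (card S)"
proof -
  obtain T K where TK: "(T, K) \<in> repairs n L H"
    "score n L \<eta> H q = real (card T) + \<bar>q - edge_density n K\<bar> / \<eta>"
    using score_attained[OF L H] .
  have "(S \<union> T, K) \<in> repairs n L G"
  proof -
    have "avoiding (S \<union> T) G = avoiding T (avoiding S H)"
      using S(2) by (simp add: avoiding_Un)
    also have "\<dots> = avoiding S (avoiding T H)"
      by (metis avoiding_Un Un_commute)
    also have "\<dots> = avoiding S (avoiding T K)"
      using TK(1) by (simp add: repairs_def)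
    also have "\<dots> = avoiding (S \<union> T) K"
      by (metis avoiding_Un Un_commute)
    finally show ?thesis using TK(1) S(1) by (simp add: repairs_def)
  qed
  from score_le[OF this, of \<eta> q]
  have "score n L \<eta> G q \<le> real (card (S \<union> T)) + \<bar>q - edge_density n K\<bar> / \<eta>" .
  moreover have "card (S \<union> T) \<le> card S + card T" by (rule card_Un_le)
  ultimately show ?thesis using TK(2) by linarith
qed

text \<open>The sensitivity bound on which privacy rests. It holds for all graphs, homogeneous or
  not.\<close>

lemma score_lipschitz:
  assumes "0 \<le> L" "G \<in> graphs n" "H \<in> graphs n"
  shows "\<bar>score n L \<eta> G q - score n L \<eta> H q\<bar> \<le> real (node_dist n G H)"
proof -
  obtain S where S: "card S = node_dist n G H" "S \<subseteq> {1..n}" "avoiding S G = avoiding S H"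
    using node_dist_witness[OF assms(2,3)] .
  show ?thesis
    using score_le_add_card[OF assms(1,3) S(2,3), of \<eta> q]
      score_le_add_card[OF assms(1,2) S(2) S(3)[symmetric], of \<eta> q] S(1) by linarith
qed

lemma score_homogeneous_le:
  assumes "G \<in> homogeneous n L"
  shows "score n L \<eta> G q \<le> \<bar>q - edge_density n G\<bar> / \<eta>"
  using score_le[of "{}" G n L G \<eta> q] assms by (simp add: repairs_def)

text \<open>An optimal repair either rewires more than \<open>n / 2\<close> vertices, which gives
  the cap, or its target has a density within \<open>\<eta> * card S\<close> of that of
  \<open>G\<close>, and the triangle inequality applies.\<close>

lemma score_homogeneous_ge:
  assumes L: "0 < L" and n: "n \<ge> 4" and G: "G \<in> homogeneous n L"
  defines "\<eta> \<equiv> 32 * L / real n ^ 2"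
  shows "min (\<bar>q - edge_density n G\<bar> / \<eta>) (real n / 2) \<le> score n L \<eta> G q"
proof -
  have \<eta>: "\<eta> > 0" using L n by (simp add: \<eta>_def)
  obtain S H where SH: "(S, H) \<in> repairs n L G"
    "score n L \<eta> G q = real (card S) + \<bar>q - edge_density n H\<bar> / \<eta>"
    using score_attained[OF less_imp_le[OF L] homogeneous_graph[OF G]] .
  let ?k = "real (card S)" and ?d = "edge_density n G" and ?d' = "edge_density n H"
  show ?thesis
  proof (cases "?k \<le> real n / 2")
    case False
    moreover have "0 \<le> \<bar>q - ?d'\<bar> / \<eta>" using \<eta> by simp
    ultimately show ?thesis using SH(2) by linarith
  next
    case True
    let ?N = "real (card (avoiding S (edges n)))"
    have S: "S \<subseteq> {1..n}" and av: "avoiding S G = avoiding S H" and H: "H \<in> homogeneous n L"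
      using SH(1) by (auto simp: repairs_def)
    have "\<bar>real (card (avoiding S G)) - ?d * ?N\<bar> \<le> L * ?k"
      "\<bar>real (card (avoiding S H)) - ?d' * ?N\<bar> \<le> L * ?k"
      using G H S by (auto simp: homogeneous_def)
    \<comment> \<open>Off \<open>S\<close> the two graphs coincide, so both densities predict the
      same edge count, each up to \<open>L * card S\<close>.\<close>
    then have "\<bar>?d * ?N - ?d' * ?N\<bar> \<le> 2 * L * ?k" using av by (simp add: abs_le_iff)
    then have diff: "\<bar>?d - ?d'\<bar> * ?N \<le> 2 * L * ?k"
      by (simp add: left_diff_distrib[symmetric] abs_mult)
    have ks: "card S \<le> n" using card_mono[OF _ S] by simp
    define m where "m = n - card S"
    have m: "real m \<ge> real n / 2" using True ks by (simp add: m_def)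
    \<comment> \<open>At least \<open>n / 2\<close> vertices remain, hence at least
      \<open>n^2 / 16\<close> pairs since \<open>n \<ge> 4\<close>. Together with the factor 2 above
      this gives the 32 in \<open>\<eta>\<close>.\<close>
    have "real n ^ 2 / 16 \<le> (real n / 2) * (real n / 2 - 1) / 2"
      using mult_mono[of 4 "real n" "real n" "real n"] n by (simp add: power2_eq_square field_simps)
    also have "\<dots> \<le> real m * (real m - 1) / 2"
      using m n by (intro divide_right_mono mult_mono) auto
    also have "\<dots> = ?N" by (simp add: card_avoiding_edges[OF S] m_def choose_two_real)
    finally have N: "real n ^ 2 / 16 \<le> ?N" .
    have "\<bar>?d - ?d'\<bar> * (real n ^ 2 / 16) \<le> \<bar>?d - ?d'\<bar> * ?N"
      using N by (intro mult_left_mono) auto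
    with diff have "\<bar>?d - ?d'\<bar> * (real n ^ 2 / 16) \<le> 2 * L * ?k" by linarith
    then have "\<bar>?d - ?d'\<bar> / \<eta> \<le> ?k"
      using n L by (simp add: \<eta>_def field_simps)
    moreover have "\<bar>q - ?d\<bar> / \<eta> \<le> \<bar>q - ?d'\<bar> / \<eta> + \<bar>?d - ?d'\<bar> / \<eta>"
      unfolding add_divide_distrib[symmetric] using \<eta> by (intro divide_right_mono) auto
    ultimately show ?thesis using SH(2) by linarith
  qed
qed

section \<open>The exponential mechanism\<close>

text \<open>The support reaches up to 2 so that \<open>{d..d + r}\<close> lies inside it for every
  density \<open>d \<le> 1\<close> and every \<open>r \<le> 1\<close>; this gives the lower bound on
  the normalizer.\<close>

definition weight :: "nat \<Rightarrow> real \<Rightarrow> real \<Rightarrow> real \<Rightarrow> nat set set \<Rightarrow> real \<Rightarrow> ennreal" where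
  "weight n L \<eta> \<epsilon> G q = ennreal (exp (- (\<epsilon> / 2) * score n L \<eta> G q)) * indicator {0..2} q"

definition normalizer :: "nat \<Rightarrow> real \<Rightarrow> real \<Rightarrow> real \<Rightarrow> nat set set \<Rightarrow> ennreal" where
  "normalizer n L \<eta> \<epsilon> G = (\<integral>\<^sup>+ q. weight n L \<eta> \<epsilon> G q \<partial>lborel)"

definition mechanism :: "nat \<Rightarrow> real \<Rightarrow> real \<Rightarrow> real \<Rightarrow> nat set set \<Rightarrow> real measure" where
  "mechanism n L \<eta> \<epsilon> G = density lborel (\<lambda>q. weight n L \<eta> \<epsilon> G q / normalizer n L \<eta> \<epsilon> G)"

lemma borel_measurable_weight [measurable]: "weight n L \<eta> \<epsilon> G \<in> borel_measurable borel"
  unfolding weight_def[abs_def] by measurable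

text \<open>Serves twice in the privacy proof: for the numerator, and with the two graphs exchanged
  for the normalizer.\<close>

lemma weight_le:
  assumes "0 \<le> \<epsilon>" "score n L \<eta> H q \<le> score n L \<eta> G q + D"
  shows "weight n L \<eta> \<epsilon> G q \<le> ennreal (exp (\<epsilon> / 2 * D)) * weight n L \<eta> \<epsilon> H q"
proof -
  have "\<epsilon> / 2 * score n L \<eta> H q \<le> \<epsilon> / 2 * (score n L \<eta> G q + D)"
    using assms by (intro mult_left_mono) auto
  then have "exp (- (\<epsilon> / 2) * score n L \<eta> G q)
      \<le> exp (\<epsilon> / 2 * D) * exp (- (\<epsilon> / 2) * score n L \<eta> H q)"
    unfolding exp_add[symmetric] by (simp add: algebra_simps)
  then have "ennreal (exp (- (\<epsilon> / 2) * score n L \<eta> G q))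
      \<le> ennreal (exp (\<epsilon> / 2 * D)) * ennreal (exp (- (\<epsilon> / 2) * score n L \<eta> H q))"
    by (simp add: ennreal_mult[symmetric] ennreal_leI)
  then show ?thesis
    unfolding weight_def mult.assoc[symmetric] by (rule mult_right_mono) auto
qed

lemma normalizer_le_2:
  assumes "0 \<le> L" "0 < \<eta>" "0 \<le> \<epsilon>" "G \<in> graphs n"
  shows "normalizer n L \<eta> \<epsilon> G \<le> 2"
proof -
  have "weight n L \<eta> \<epsilon> G q \<le> indicator {0..2} q" for q
    using score_nonneg[OF assms(1,2,4), of q] assms(3)
    by (auto simp: weight_def indicator_def ennreal_le_1)
  then have "normalizer n L \<eta> \<epsilon> G \<le> (\<integral>\<^sup>+ q. indicator {0..2} (q::real) \<partial>lborel)"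
    unfolding normalizer_def by (intro nn_integral_mono) auto
  then show ?thesis by simp
qed

lemma normalizer_pos: "0 < normalizer n L \<eta> \<epsilon> G"
proof -
  have "\<not> (AE q in lborel. weight n L \<eta> \<epsilon> G q = 0)"
  proof
    assume "AE q in lborel. weight n L \<eta> \<epsilon> G q = 0"
    then have "AE q in lborel. q \<notin> {0..2::real}"
      by eventually_elim (auto simp: weight_def indicator_def)
    then have "emeasure lborel {0..2::real} = 0"
      by (subst (asm) AE_iff_measurable[of "{0..2}"]) auto
    then show False by simp
  qed
  then show ?thesis
    unfolding normalizer_def zero_less_iff_neq_zero by (subst nn_integral_0_iff_AE) auto
qed

lemma sets_mechanism [simp, measurable_cong]: "sets (mechanism n L \<eta> \<epsilon> G) = sets borel"
  by (simp add: mechanism_def)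

lemma nn_integral_mechanism:
  assumes "f \<in> borel_measurable borel"
  shows "(\<integral>\<^sup>+ x. f x \<partial>mechanism n L \<eta> \<epsilon> G)
    = (\<integral>\<^sup>+ x. weight n L \<eta> \<epsilon> G x * f x \<partial>lborel) / normalizer n L \<eta> \<epsilon> G"
proof -
  have [measurable]: "f \<in> borel_measurable borel" by fact
  have "(\<integral>\<^sup>+ x. f x \<partial>mechanism n L \<eta> \<epsilon> G)
    = (\<integral>\<^sup>+ x. weight n L \<eta> \<epsilon> G x / normalizer n L \<eta> \<epsilon> G * f x \<partial>lborel)"
    unfolding mechanism_def by (subst nn_integral_density) auto
  also have "\<dots> = (\<integral>\<^sup>+ x. weight n L \<eta> \<epsilon> G x * f x / normalizer n L \<eta> \<epsilon> G \<partial>lborel)"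
    by (simp add: divide_ennreal_def mult_ac)
  also have "\<dots> = (\<integral>\<^sup>+ x. weight n L \<eta> \<epsilon> G x * f x \<partial>lborel) / normalizer n L \<eta> \<epsilon> G"
    by (rule nn_integral_divide) auto
  finally show ?thesis .
qed

lemma prob_space_mechanism:
  assumes "0 \<le> L" "0 < \<eta>" "0 \<le> \<epsilon>" "G \<in> graphs n"
  shows "prob_space (mechanism n L \<eta> \<epsilon> G)"
proof
  have "emeasure (mechanism n L \<eta> \<epsilon> G) (space (mechanism n L \<eta> \<epsilon> G))
      = (\<integral>\<^sup>+ x. 1 \<partial>mechanism n L \<eta> \<epsilon> G)" by simp
  also have "\<dots> = normalizer n L \<eta> \<epsilon> G / normalizer n L \<eta> \<epsilon> G"
    by (subst nn_integral_mechanism) (auto simp: normalizer_def)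
  also have "\<dots> = 1"
    using normalizer_pos[of n L \<eta> \<epsilon> G] normalizer_le_2[OF assms]
    by (intro ennreal_divide_self) (auto simp: le_less_trans[of _ 2 top])
  finally show "emeasure (mechanism n L \<eta> \<epsilon> G) (space (mechanism n L \<eta> \<epsilon> G)) = 1" .
qed

text \<open>The numerator and the normalizer each change by a factor of at most
  \<open>exp (\<epsilon> / 2 * node_dist n G H)\<close>, which explains the halved
  \<open>\<epsilon>\<close> in \<open>weight\<close>.\<close>

lemma node_dp_mechanism:
  assumes "0 \<le> L" "0 < \<eta>" "0 \<le> \<epsilon>"
  shows "node_dp n \<epsilon> (mechanism n L \<eta> \<epsilon>)"
  unfolding node_dp_def
proof (intro conjI ballI)
  fix G assume G: "G \<in> graphs n"
  show "prob_space (mechanism n L \<eta> \<epsilon> G)" by (rule prob_space_mechanism[OF assms G])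
  fix H and S :: "real set" assume H: "H \<in> graphs n" and S[measurable]: "S \<in> sets borel"
  interpret G: prob_space "mechanism n L \<eta> \<epsilon> G" by (rule prob_space_mechanism[OF assms G])
  interpret H: prob_space "mechanism n L \<eta> \<epsilon> H" by (rule prob_space_mechanism[OF assms H])
  let ?c = "ennreal (exp (\<epsilon> / 2 * node_dist n G H))"
  let ?I = "\<lambda>G. \<integral>\<^sup>+ x. weight n L \<eta> \<epsilon> G x * indicator S x \<partial>lborel"
  have em: "emeasure (mechanism n L \<eta> \<epsilon> G) S = ?I G / normalizer n L \<eta> \<epsilon> G" for G
    using nn_integral_mechanism[of "indicator S" n L \<eta> \<epsilon> G] by simp
  have *: "score n L \<eta> H q \<le> score n L \<eta> G q + real (node_dist n G H)"
    "score n L \<eta> G q \<le> score n L \<eta> H q + real (node_dist n G H)" for q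
    using score_lipschitz[OF assms(1) G H, of \<eta> q] by linarith+
  have "?I G \<le> (\<integral>\<^sup>+ x. ?c * (weight n L \<eta> \<epsilon> H x * indicator S x) \<partial>lborel)"
    unfolding mult.assoc[symmetric]
    by (intro nn_integral_mono mult_right_mono weight_le assms *) auto
  then have I: "?I G \<le> ?c * ?I H" by (simp add: nn_integral_cmult)
  have "normalizer n L \<eta> \<epsilon> H \<le> (\<integral>\<^sup>+ x. ?c * weight n L \<eta> \<epsilon> G x \<partial>lborel)"
    unfolding normalizer_def by (intro nn_integral_mono weight_le assms *)
  then have Z: "normalizer n L \<eta> \<epsilon> H \<le> ?c * normalizer n L \<eta> \<epsilon> G"
    by (simp add: nn_integral_cmult normalizer_def)
  have bounds: "?I K \<le> normalizer n L \<eta> \<epsilon> K" "normalizer n L \<eta> \<epsilon> K < top" if "K \<in> graphs n" for K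
  proof -
    show "?I K \<le> normalizer n L \<eta> \<epsilon> K"
      unfolding normalizer_def by (intro nn_integral_mono) (simp split: split_indicator)
    show "normalizer n L \<eta> \<epsilon> K < top"
      by (rule le_less_trans[OF normalizer_le_2[OF assms that]]) simp
  qed
  have fin: "?I K < top" if "K \<in> graphs n" for K
    by (rule le_less_trans[OF bounds[OF that]])
  \<comment> \<open>All four integrals are finite, so the quotients can be compared by
    cross-multiplication over the reals.\<close>
  obtain zG zH iG iH where eqs: "normalizer n L \<eta> \<epsilon> G = ennreal zG" "normalizer n L \<eta> \<epsilon> H = ennreal zH"
    "?I G = ennreal iG" "?I H = ennreal iH" and nn: "0 \<le> zG" "0 \<le> zH" "0 \<le> iG" "0 \<le> iH"
    using fin[OF G] fin[OF H] bounds(2)[OF G] bounds(2)[OF H] unfolding less_top_ennreal by blast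
  define c where "c = exp (\<epsilon> / 2 * node_dist n G H)"
  have c: "c > 0" "c * c = exp (\<epsilon> * real (node_dist n G H))"
    by (simp_all add: c_def exp_add[symmetric])
  have zpos: "zG > 0" "zH > 0"
    using normalizer_pos[of n L \<eta> \<epsilon> G] normalizer_pos[of n L \<eta> \<epsilon> H] by (simp_all add: eqs)
  have "iG \<le> c * iH" "zH \<le> c * zG"
    using I Z nn c(1) unfolding eqs c_def[symmetric] by (simp_all add: ennreal_mult[symmetric])
  then have "iG * zH \<le> (c * iH) * (c * zG)" using nn c(1) by (intro mult_mono) auto
  then have "iG / zG \<le> (c * c) * (iH / zH)"
    using zpos by (simp add: field_simps)
  then have "emeasure (mechanism n L \<eta> \<epsilon> G) S
      \<le> ennreal (exp (\<epsilon> * node_dist n G H)) * emeasure (mechanism n L \<eta> \<epsilon> H) S"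
    using nn zpos unfolding em eqs c(2)[symmetric]
    by (simp add: divide_ennreal ennreal_mult[symmetric] c(1) less_imp_le)
  then show "measure (mechanism n L \<eta> \<epsilon> G) S
      \<le> exp (\<epsilon> * real (node_dist n G H)) * measure (mechanism n L \<eta> \<epsilon> H) S"
    by (simp add: G.emeasure_eq_measure H.emeasure_eq_measure ennreal_mult[symmetric])
qed simp

section \<open>Accuracy of the mechanism\<close>

lemma nn_integral_sq_exp_abs:
  fixes a d :: real
  assumes a: "0 < a"
  shows "(\<integral>\<^sup>+ x. ennreal ((x - d)\<^sup>2 * exp (- a * \<bar>x - d\<bar>)) \<partial>lborel) \<le> ennreal (4 / a ^ 3)"
proof -
  \<comment> \<open>\<open>erlang_density 0 a\<close> is the exponential density, which vanishes on
    negative reals. The integral thus splits at \<open>d\<close> into two reflected copies of its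
    second moment \<open>2 / a^2\<close>, each divided by \<open>a\<close>.\<close>
  define g where "g = (\<lambda>x::real. ennreal (erlang_density 0 a x * x ^ 2))"
  have [measurable]: "g \<in> borel_measurable borel" unfolding g_def by measurable
  have g: "(\<integral>\<^sup>+ x. g x \<partial>lborel) = ennreal (2 / a ^ 2)"
    using nn_integral_erlang_ith_moment[OF a, of 0 2] by (simp add: g_def)
  have shift: "(\<integral>\<^sup>+ x. g (s * x + t) \<partial>lborel) = ennreal (2 / a ^ 2)" if "\<bar>s\<bar> = 1" for s t
    using nn_integral_real_affine[of g s t] that g by (force simp: add.commute)
  have "(\<integral>\<^sup>+ x. ennreal ((x - d)\<^sup>2 * exp (- a * \<bar>x - d\<bar>)) \<partial>lborel)
      \<le> (\<integral>\<^sup>+ x. ennreal (1 / a) * (g (1 * x + - d) + g (- 1 * x + d)) \<partial>lborel)"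
  proof (intro nn_integral_mono)
    fix x :: real
    have 1: "ennreal (1 / a) * g y = ennreal (y\<^sup>2 * exp (- a * \<bar>y\<bar>))" if "y \<ge> 0" for y
      using that a by (simp add: g_def erlang_density_def ennreal_mult[symmetric] field_simps)
    show "ennreal ((x - d)\<^sup>2 * exp (- a * \<bar>x - d\<bar>)) \<le> ennreal (1 / a) * (g (1 * x + - d) + g (- 1 * x + d))"
      using 1[of "x - d"] 1[of "d - x"]
      by (cases "x \<ge> d") (auto simp: distrib_left power2_commute abs_minus_commute)
  qed
  also have "\<dots> = ennreal (1 / a) * (ennreal (2 / a ^ 2) + ennreal (2 / a ^ 2))"
    using shift[of 1 "-d"] shift[of "-1" d] by (simp add: nn_integral_cmult nn_integral_add)
  also have "\<dots> = ennreal (4 / a ^ 3)"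
    using a by (simp add: ennreal_mult[symmetric] ennreal_plus[symmetric] del: ennreal_plus)
      (simp add: field_simps power2_eq_square power3_eq_cube)
  finally show ?thesis .
qed


text \<open>The unnormalized second moment is at most \<open>40 * r^3\<close> and the normalizer at
  least \<open>r / 2\<close>. The tail hypothesis has the form \<open>r^3\<close> so that the capped
  part of the score does not exceed the order of the main part.\<close>

lemma mechanism_concentration:
  assumes L: "0 < L" and n: "n \<ge> 4" and G: "G \<in> homogeneous n L" and \<epsilon>: "0 < \<epsilon>"
    and r: "r = 32 * L / real n ^ 2 / \<epsilon>" "r \<le> 1" "exp (- \<epsilon> * real n / 4) \<le> r ^ 3"
  shows "(\<integral>\<^sup>+ x. ennreal ((x - edge_density n G)\<^sup>2) \<partial>mechanism n L (32 * L / real n ^ 2) \<epsilon> G)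
    \<le> ennreal (80 * r ^ 2)"
proof -
  define \<eta> where "\<eta> = 32 * L / real n ^ 2"
  define d where "d = edge_density n G"
  define a where "a = \<epsilon> / (2 * \<eta>)"
  have \<eta>: "\<eta> > 0" using L n by (simp add: \<eta>_def)
  have r\<eta>: "r = \<eta> / \<epsilon>" by (simp add: r \<eta>_def)
  have rpos: "r > 0" using \<eta> \<epsilon> by (simp add: r\<eta>)
  have a: "a > 0" "4 / a ^ 3 = 32 * r ^ 3" using \<eta> \<epsilon> by (simp_all add: a_def r\<eta> power_divide power_mult_distrib)
  have Gg: "G \<in> graphs n" by (rule homogeneous_graph[OF G])
  have d: "0 \<le> d" "d \<le> 1" using edge_density_bounds[OF Gg] by (simp_all add: d_def)
  let ?e = "exp (- \<epsilon> * real n / 4)"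
  have "weight n L \<eta> \<epsilon> G x * ennreal ((x - d)\<^sup>2)
      \<le> ennreal ((x - d)\<^sup>2 * exp (- a * \<bar>x - d\<bar>)) + ennreal (4 * ?e) * indicator {0..2} x" for x
  proof (cases "x \<in> {0..2}")
    case True
    have "exp (- (\<epsilon> / 2) * score n L \<eta> G x) \<le> exp (- (\<epsilon> / 2) * min (\<bar>x - d\<bar> / \<eta>) (real n / 2))"
      using score_homogeneous_ge[OF L n G, of x] \<epsilon> by (simp add: \<eta>_def d_def)
    \<comment> \<open>The exponential of a capped score is at most the sum of the uncapped
      exponential and the value at the cap.\<close>
    also have "\<dots> \<le> exp (- a * \<bar>x - d\<bar>) + ?e"
      by (cases "\<bar>x - d\<bar> / \<eta> \<le> real n / 2") (simp_all add: min_def a_def)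
    finally have 1: "exp (- (\<epsilon> / 2) * score n L \<eta> G x) * (x - d)\<^sup>2
        \<le> (exp (- a * \<bar>x - d\<bar>) + ?e) * (x - d)\<^sup>2"
      by (rule mult_right_mono) auto
    have "(x - d)\<^sup>2 \<le> 2\<^sup>2"
      using True d by (intro abs_le_square_iff[THEN iffD1]) auto
    then have 2: "?e * (x - d)\<^sup>2 \<le> ?e * 4" by (intro mult_left_mono) auto
    have 3: "exp (- (\<epsilon> / 2) * score n L \<eta> G x) * (x - d)\<^sup>2
        \<le> (x - d)\<^sup>2 * exp (- a * \<bar>x - d\<bar>) + 4 * ?e"
      using order_trans[OF 1[unfolded distrib_right] add_left_mono[OF 2]]
      by (simp only: mult.commute[of "(x - d)\<^sup>2"] mult.commute[of 4])
    have "ennreal (exp (- (\<epsilon> / 2) * score n L \<eta> G x)) * ennreal ((x - d)\<^sup>2)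
        \<le> ennreal ((x - d)\<^sup>2 * exp (- a * \<bar>x - d\<bar>)) + ennreal (4 * ?e)"
      using ennreal_leI[OF 3] by (subst (asm) ennreal_plus) (simp_all add: ennreal_mult)
    then show ?thesis using True by (simp add: weight_def)
  qed (simp add: weight_def)
  then have "(\<integral>\<^sup>+ x. weight n L \<eta> \<epsilon> G x * ennreal ((x - d)\<^sup>2) \<partial>lborel)
      \<le> (\<integral>\<^sup>+ x. ennreal ((x - d)\<^sup>2 * exp (- a * \<bar>x - d\<bar>)) + ennreal (4 * ?e) * indicator {0..2} x \<partial>lborel)"
    by (intro nn_integral_mono)
  also have "\<dots> = (\<integral>\<^sup>+ x. ennreal ((x - d)\<^sup>2 * exp (- a * \<bar>x - d\<bar>)) \<partial>lborel) + ennreal (4 * ?e) * 2"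
    by (simp add: nn_integral_add nn_integral_cmult)
  also have "\<dots> \<le> ennreal (4 / a ^ 3) + ennreal (4 * ?e) * 2"
    by (intro add_right_mono nn_integral_sq_exp_abs a)
  also have "\<dots> = ennreal (32 * r ^ 3 + 8 * ?e)"
  proof -
    have "ennreal (4 * ?e) * 2 = ennreal (8 * ?e)" using ennreal_mult[of "4 * ?e" 2] by simp
    then show ?thesis using a rpos by simp
  qed
  also have "\<dots> \<le> ennreal (40 * r ^ 3)" using r(3) by (intro ennreal_leI) simp
  finally have num: "(\<integral>\<^sup>+ x. weight n L \<eta> \<epsilon> G x * ennreal ((x - d)\<^sup>2) \<partial>lborel) \<le> ennreal (40 * r ^ 3)" .
  \<comment> \<open>Within \<open>r\<close> of \<open>d\<close> the exponent is at least
    \<open>- 1 / 2\<close>, so the weight is at least \<open>1 / 2\<close> by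
    \<open>1 + x \<le> exp x\<close>.\<close>
  have "ennreal (1 / 2) * indicator {d..d + r} x \<le> weight n L \<eta> \<epsilon> G x" for x
  proof (cases "x \<in> {d..d + r}")
    case True
    have "\<epsilon> / 2 * score n L \<eta> G x \<le> \<epsilon> / 2 * (\<bar>x - d\<bar> / \<eta>)"
      unfolding d_def using score_homogeneous_le[OF G, of \<eta> x] \<epsilon> by (intro mult_left_mono) auto
    also have "\<dots> \<le> \<epsilon> / 2 * (r / \<eta>)"
      using True \<eta> \<epsilon> by (intro mult_left_mono divide_right_mono) auto
    also have "\<dots> = 1 / 2" using \<eta> \<epsilon> by (simp add: r\<eta>)
    finally have "1 / 2 \<le> exp (- (\<epsilon> / 2) * score n L \<eta> G x)"
      using exp_ge_add_one_self[of "- (\<epsilon> / 2) * score n L \<eta> G x"] by linarith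
    then have "ennreal (1 / 2) \<le> ennreal (exp (- (\<epsilon> / 2) * score n L \<eta> G x))"
      by (rule ennreal_leI)
    moreover have "indicator {d..d + r} x = (1 :: ennreal)" "indicator {0..2} x = (1 :: ennreal)"
      using True d r(2) by auto
    ultimately show ?thesis unfolding weight_def by (simp only: mult_1_right)
  qed (auto simp: indicator_def)
  then have "(\<integral>\<^sup>+ x. ennreal (1 / 2) * indicator {d..d + r} x \<partial>lborel) \<le> normalizer n L \<eta> \<epsilon> G"
    unfolding normalizer_def by (rule nn_integral_mono)
  moreover have "(\<integral>\<^sup>+ x. ennreal (1 / 2) * indicator {d..d + r} x \<partial>lborel) = ennreal (1 / 2) * ennreal r"
    using rpos by (subst nn_integral_cmult_indicator) auto
  moreover have "ennreal (1 / 2) * ennreal r = ennreal (r / 2)"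
    using rpos ennreal_mult[of "1 / 2" r] by simp
  ultimately have Z: "ennreal (r / 2) \<le> normalizer n L \<eta> \<epsilon> G"
    by (simp only:)
  have "ennreal (40 * r ^ 3) = ennreal (80 * r\<^sup>2) * ennreal (r / 2)"
  proof -
    have "40 * r ^ 3 = (80 * r\<^sup>2) * (r / 2)" by (simp add: power2_eq_square power3_eq_cube)
    also have "ennreal \<dots> = ennreal (80 * r\<^sup>2) * ennreal (r / 2)"
      using rpos by (intro ennreal_mult) auto
    finally show ?thesis .
  qed
  also have "\<dots> \<le> ennreal (80 * r\<^sup>2) * normalizer n L \<eta> \<epsilon> G"
    using Z by (rule mult_left_mono) simp
  also have "\<dots> = normalizer n L \<eta> \<epsilon> G * ennreal (80 * r\<^sup>2)" by (rule mult.commute)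
  finally have "(\<integral>\<^sup>+ x. weight n L \<eta> \<epsilon> G x * ennreal ((x - d)\<^sup>2) \<partial>lborel)
      \<le> normalizer n L \<eta> \<epsilon> G * ennreal (80 * r\<^sup>2)"
    by (rule order_trans[OF num])
  moreover have "(\<integral>\<^sup>+ x. ennreal ((x - d)\<^sup>2) \<partial>mechanism n L \<eta> \<epsilon> G)
      = (\<integral>\<^sup>+ x. weight n L \<eta> \<epsilon> G x * ennreal ((x - d)\<^sup>2) \<partial>lborel) / normalizer n L \<eta> \<epsilon> G"
    by (rule nn_integral_mechanism) measurable
  ultimately show ?thesis
    unfolding d_def[symmetric] \<eta>_def[symmetric]
    by (simp only: divide_le_posI_ennreal[OF normalizer_pos])
qed

text \<open>A crude bound for the rare graphs that are not homogeneous: output and \<open>p\<close>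
  both lie in \<open>{0..2}\<close>.\<close>

lemma mechanism_risk_le_4:
  assumes "0 \<le> L" "0 < \<eta>" "0 \<le> \<epsilon>" "G \<in> graphs n" and p: "0 \<le> p" "p \<le> 1"
  shows "(\<integral>\<^sup>+ x. ennreal ((x - p)\<^sup>2) \<partial>mechanism n L \<eta> \<epsilon> G) \<le> 4"
proof -
  interpret prob_space "mechanism n L \<eta> \<epsilon> G" by (rule prob_space_mechanism[OF assms(1-4)])
  have "AE x in mechanism n L \<eta> \<epsilon> G. x \<in> {0..2}"
    unfolding mechanism_def by (subst AE_density) (auto simp: weight_def indicator_def)
  then have "AE x in mechanism n L \<eta> \<epsilon> G. ennreal ((x - p)\<^sup>2) \<le> 4"
  proof eventually_elim
    case (elim x)
    then have "(x - p)\<^sup>2 \<le> 2\<^sup>2" using p by (intro abs_le_square_iff[THEN iffD1]) auto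
    then show ?case using ennreal_leI[of _ 4] by simp
  qed
  from nn_integral_mono_AE[OF this] show ?thesis by (simp add: emeasure_space_1)
qed

text \<open>Separates the privacy noise from the sampling error by
  \<open>(a + b)^2 \<le> 2 * a^2 + 2 * b^2\<close>.\<close>

lemma mechanism_risk_homogeneous:
  assumes "0 < L" "n \<ge> 4" and G: "G \<in> homogeneous n L" and "0 < \<epsilon>"
    and "r = 32 * L / real n ^ 2 / \<epsilon>" "r \<le> 1" "exp (- \<epsilon> * real n / 4) \<le> r ^ 3"
  shows "(\<integral>\<^sup>+ x. ennreal ((x - p)\<^sup>2) \<partial>mechanism n L (32 * L / real n ^ 2) \<epsilon> G)
    \<le> ennreal (160 * r ^ 2 + 2 * (edge_density n G - p)\<^sup>2)"
proof -
  let ?d = "edge_density n G" and ?\<eta> = "32 * L / real n ^ 2"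
  interpret prob_space "mechanism n L ?\<eta> \<epsilon> G"
    using assms by (intro prob_space_mechanism homogeneous_graph[OF G]) auto
  have ennreal_double: "2 * ennreal y = ennreal (2 * y)" if "0 \<le> y" for y
    using that ennreal_mult[of 2 y] by simp
  have "(x - p)\<^sup>2 \<le> 2 * (x - ?d)\<^sup>2 + 2 * (?d - p)\<^sup>2" for x
    using zero_le_power2[of "(x - ?d) - (?d - p)"] by (simp add: power2_eq_square algebra_simps)
  then have "(\<integral>\<^sup>+ x. ennreal ((x - p)\<^sup>2) \<partial>mechanism n L ?\<eta> \<epsilon> G)
    \<le> (\<integral>\<^sup>+ x. 2 * ennreal ((x - ?d)\<^sup>2) + ennreal (2 * (?d - p)\<^sup>2) \<partial>mechanism n L ?\<eta> \<epsilon> G)"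
    by (intro nn_integral_mono)
      (simp add: ennreal_double ennreal_plus[symmetric] ennreal_leI del: ennreal_plus)
  also have "\<dots> = 2 * (\<integral>\<^sup>+ x. ennreal ((x - ?d)\<^sup>2) \<partial>mechanism n L ?\<eta> \<epsilon> G) + ennreal (2 * (?d - p)\<^sup>2)"
    by (simp add: nn_integral_add nn_integral_cmult emeasure_space_1)
  also have "\<dots> \<le> 2 * ennreal (80 * r ^ 2) + ennreal (2 * (?d - p)\<^sup>2)"
    by (intro add_right_mono mult_left_mono mechanism_concentration assms) auto
  also have "\<dots> = ennreal (160 * r ^ 2 + 2 * (?d - p)\<^sup>2)"
    by (simp add: ennreal_double ennreal_plus[symmetric] del: ennreal_plus)
  finally show ?thesis .
qed

section \<open>Homogeneity of random graphs\<close>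

lemma exp_le_quadratic:
  fixes t :: real
  assumes "\<bar>t\<bar> \<le> 1"
  shows "exp t \<le> 1 + t + t\<^sup>2"
proof (cases "t \<ge> 0")
  case True
  then show ?thesis using exp_bound[of t] assms by simp
next
  case False
  define s where "s = - t"
  have s: "s \<ge> 0" using False by (simp add: s_def)
  \<comment> \<open>For \<open>t = - s\<close> the claim becomes
    \<open>1 \<le> (1 - s + s^2) * exp s\<close>, and \<open>exp s\<close> is at least its quadratic
    Taylor polynomial.\<close>
  have "1 \<le> (1 - s + s\<^sup>2) * (1 + s + s\<^sup>2 / 2)"
  proof -
    have "(1 - s + s\<^sup>2) * (1 + s + s\<^sup>2 / 2) = 1 + s ^ 2 / 2 + s ^ 3 / 2 + s ^ 4 / 2"
      by (simp add: field_simps power2_eq_square power3_eq_cube power4_eq_xxxx)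
    then show ?thesis using s by simp
  qed
  also have "\<dots> \<le> (1 - s + s\<^sup>2) * exp s"
    using exp_lower_Taylor_quadratic[OF s] zero_le_power2[of "s - 1 / 2"]
    by (intro mult_left_mono) (auto simp: power2_eq_square algebra_simps)
  finally show ?thesis by (simp add: s_def exp_minus field_simps)
qed

lemma expectation_binomial_exp:
  assumes "p \<in> {0..1}"
  shows "measure_pmf.expectation (binomial_pmf m p) (\<lambda>k. exp (t * real k)) = (p * exp t + (1 - p)) ^ m"
  using assms
  by (subst expectation_binomial_pmf')
    (auto simp: binomial_ring power_mult_distrib exp_of_nat2_mult[symmetric] mult_ac intro!: sum.cong)

lemma expectation_binomial_sq_dev:
  assumes p: "p \<in> {0..1}"
  shows "measure_pmf.expectation (binomial_pmf m p) (\<lambda>k. (real k - real m * p)\<^sup>2) = real m * p * (1 - p)"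
proof -
  have "measure_pmf.expectation (binomial_pmf m p) (\<lambda>k. (real k - real m * p)\<^sup>2)
      = (\<Sum>k\<le>m. (real k - real m * p)\<^sup>2 * Bernstein m k p)"
    using p by (subst expectation_binomial_pmf') (auto simp: Bernstein_def mult_ac)
  \<comment> \<open>The square is written in terms of \<open>k * (k - 1)\<close>, \<open>k\<close>
    and 1, whose sums against Bernstein polynomials are known.\<close>
  also have "\<dots> = (\<Sum>k\<le>m. real k * (real k - 1) * Bernstein m k p)
      + (1 - 2 * real m * p) * (\<Sum>k\<le>m. real k * Bernstein m k p)
      + (real m * p)\<^sup>2 * (\<Sum>k\<le>m. Bernstein m k p)"
    unfolding sum_distrib_left sum.distrib[symmetric]
    by (intro sum.cong refl) (simp add: power2_eq_square algebra_simps)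
  also have "\<dots> = real m * p * (1 - p)"
    unfolding sum_kk_Bernstein sum_k_Bernstein sum_Bernstein
    by (simp add: power2_eq_square algebra_simps)
  finally show ?thesis .
qed

text \<open>Markov's inequality for the exponential moment. The sign of \<open>t\<close> selects the
  upper or the lower tail.\<close>

lemma binomial_chernoff:
  assumes p: "p \<in> {0..1}" and t: "\<bar>t\<bar> \<le> 1"
  shows "measure_pmf.prob (binomial_pmf m p) {k. a \<le> t * (real k - real m * p)}
    \<le> exp (real m * p * t\<^sup>2 - a)"
proof -
  let ?B = "binomial_pmf m p" and ?A = "{k. a \<le> t * (real k - real m * p)}"
  have fin: "finite (set_pmf ?B)" by (rule finite_set_pmf_binomial_pmf[OF p])
  have "measure_pmf.prob ?B ?A = measure_pmf.expectation ?B (indicator ?A)" by simp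
  also have "\<dots> \<le> measure_pmf.expectation ?B (\<lambda>k. exp (- t * real m * p - a) * exp (t * real k))"
    by (intro integral_mono integrable_measure_pmf_finite fin)
      (auto simp: indicator_def exp_add[symmetric] algebra_simps)
  also have "\<dots> = exp (- t * real m * p - a) * (p * exp t + (1 - p)) ^ m"
    by (simp add: expectation_binomial_exp[OF p])
  also have "\<dots> \<le> exp (- t * real m * p - a) * exp (p * (t + t\<^sup>2)) ^ m"
  proof (intro mult_left_mono power_mono)
    have "p * exp t \<le> p * (1 + t + t\<^sup>2)"
      using p exp_le_quadratic[OF t] by (intro mult_left_mono) auto
    then have "p * exp t \<le> p + p * (t + t\<^sup>2)" by (simp add: algebra_simps)
    then show "p * exp t + (1 - p) \<le> exp (p * (t + t\<^sup>2))"
      using exp_ge_add_one_self[of "p * (t + t\<^sup>2)"] by linarith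
  qed (use p in auto)
  also have "\<dots> = exp (real m * p * t\<^sup>2 - a)"
    by (simp add: exp_of_nat_mult[symmetric] exp_add[symmetric] algebra_simps)
  finally show ?thesis .
qed

section \<open>Edge counts and homogeneity of the random graph\<close>

lemma set_erdos_renyi: "set_pmf (erdos_renyi n p) \<subseteq> graphs n"
  by (auto simp: erdos_renyi_def graphs_def)

text \<open>Independent edge indicators restricted to \<open>E\<close> are again independent, and
  the number of successes among them is binomial.\<close>

lemma erdos_renyi_card_Int:
  assumes E: "E \<subseteq> edges n" and p: "p \<in> {0..1}"
  shows "map_pmf (\<lambda>G. card (G \<inter> E)) (erdos_renyi n p) = binomial_pmf (card E) p"
proof -
  have finE: "finite E" using E finite_edges finite_subset by blast
  have "binomial_pmf (card E) p
      = map_pmf (\<lambda>f. card {e \<in> E. f e}) (Pi_pmf E False (\<lambda>_. bernoulli_pmf p))"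
    by (rule binomial_pmf_altdef'[OF finE refl p])
  also have "\<dots> = map_pmf (\<lambda>f. card {e \<in> E. f e}) (Pi_pmf (edges n) False (\<lambda>_. bernoulli_pmf p))"
    unfolding Pi_pmf_subset[OF finite_edges E] by (simp add: pmf.map_comp o_def cong: conj_cong)
  also have "\<dots> = map_pmf (\<lambda>G. card (G \<inter> E)) (erdos_renyi n p)"
    using E by (auto simp: erdos_renyi_def pmf.map_comp o_def intro!: map_pmf_cong arg_cong[of _ _ card])
  finally show ?thesis by simp
qed

text \<open>Edges touching \<open>S\<close> are counted instead of those avoiding it, because at
  most \<open>n * card S\<close> pairs touch \<open>S\<close>. The bound decays geometrically in
  \<open>card S\<close>, as the union bound over all \<open>S\<close> requires.\<close>

lemma erdos_renyi_touching_deviation: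
  assumes p: "p \<in> {0..1}" "p \<le> r" and n: "n \<ge> 2" and r: "ln (real n) / real n \<le> r"
    and S: "S \<subseteq> {1..n}"
  shows "measure_pmf.prob (erdos_renyi n p)
    {G. 7 * sqrt (real n * r * ln (real n)) * real (card S)
        < \<bar>real (card (G \<inter> touching S (edges n))) - p * real (card (touching S (edges n)))\<bar>}
    \<le> 2 * (1 / real n ^ 6) ^ card S"
proof -
  define E where "E = touching S (edges n)"
  let ?m = "real (card E)" and ?B = "binomial_pmf (card E) p" and ?k = "real (card S)"
  define L where "L = 7 * sqrt (real n * r * ln (real n))"
  \<comment> \<open>the Chernoff parameter that balances the variance term \<open>n r t\<^sup>2\<close> against \<open>ln n\<close>; it is at most 1\<close>
  define t where "t = sqrt (ln (real n) / (real n * r))"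
  have ln: "ln (real n) > 0" using n by simp
  have rpos: "r > 0" using r n ln by (meson divide_pos_pos less_le_trans of_nat_0_less_iff pos2)
  have nr: "ln (real n) \<le> real n * r" using r n by (simp add: field_simps)
  have t: "0 < t" "t \<le> 1" "t\<^sup>2 = ln (real n) / (real n * r)"
    using n ln rpos nr by (auto simp: t_def)
  have Lt: "L * t = 7 * ln (real n)"
  proof -
    have "sqrt (real n * r * ln (real n)) * t = sqrt ((ln (real n))\<^sup>2)"
      unfolding t_def real_sqrt_mult[symmetric] using n rpos by (simp add: power2_eq_square)
    then show ?thesis using ln by (simp add: L_def)
  qed
  have mpt: "?m * p * t\<^sup>2 \<le> ?k * ln (real n)"
  proof -
    have "?m \<le> ?k * real n" using card_touching_edges_le[OF S] by (simp add: E_def flip: of_nat_mult)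
    then have "?m * p * t\<^sup>2 \<le> (?k * real n) * r * t\<^sup>2" using p by (intro mult_right_mono mult_mono) auto
    then show ?thesis using n rpos by (simp add: t(3))
  qed
  have tail: "measure_pmf.prob ?B {k. 7 * ln (real n) * ?k \<le> s * (real k - ?m * p)}
      \<le> (1 / real n ^ 6) ^ card S" if s: "s = t \<or> s = - t" for s
  proof -
    have "measure_pmf.prob ?B {k. 7 * ln (real n) * ?k \<le> s * (real k - ?m * p)}
        \<le> exp (?m * p * s\<^sup>2 - 7 * ln (real n) * ?k)"
      using t s by (intro binomial_chernoff p) auto
    \<comment> \<open>The variance term uses up one of the 7 multiples of \<open>ln n\<close> and
      leaves 6, hence the power \<open>n^6\<close>.\<close>
    also have "\<dots> \<le> exp (?k * (- 6 * ln (real n)))"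
      using mpt s by (auto simp: algebra_simps)
    also have "\<dots> = exp (- (6 * ln (real n))) ^ card S"
      using exp_of_nat_mult[of "card S" "- (6 * ln (real n))"] by simp
    also have "exp (- (6 * ln (real n))) = 1 / real n ^ 6"
      using n exp_of_nat_mult[of 6 "ln (real n)"] by (simp add: exp_minus field_simps)
    finally show ?thesis .
  qed
  have "measure_pmf.prob (erdos_renyi n p) {G. L * ?k < \<bar>real (card (G \<inter> E)) - p * ?m\<bar>}
      = measure_pmf.prob (map_pmf (\<lambda>G. card (G \<inter> E)) (erdos_renyi n p)) {k. L * ?k < \<bar>real k - p * ?m\<bar>}"
    by (simp add: vimage_def)
  also have "\<dots> = measure_pmf.prob ?B {k. L * ?k < \<bar>real k - p * ?m\<bar>}"
    by (subst erdos_renyi_card_Int[OF _ p(1)]) (auto simp: E_def touching_def)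
  also have "\<dots> \<le> measure_pmf.prob ?B ({k. 7 * ln (real n) * ?k \<le> t * (real k - ?m * p)}
      \<union> {k. 7 * ln (real n) * ?k \<le> - t * (real k - ?m * p)})"
  proof (intro measure_pmf.finite_measure_mono subsetI)
    fix k assume "k \<in> {k. L * ?k < \<bar>real k - p * ?m\<bar>}"
    then have "t * (L * ?k) \<le> t * \<bar>real k - p * ?m\<bar>" using t by (intro mult_left_mono) auto
    also have "t * (L * ?k) = 7 * ln (real n) * ?k" unfolding Lt[symmetric] by simp
    also have "t * \<bar>real k - p * ?m\<bar> = \<bar>t * (real k - ?m * p)\<bar>"
      using t by (simp add: abs_mult mult.commute)
    finally have "7 * ln (real n) * ?k \<le> \<bar>t * (real k - ?m * p)\<bar>" .
    then show "k \<in> {k. 7 * ln (real n) * ?k \<le> t * (real k - ?m * p)}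
      \<union> {k. 7 * ln (real n) * ?k \<le> - t * (real k - ?m * p)}" by auto
  qed auto
  also have "\<dots> \<le> measure_pmf.prob ?B {k. 7 * ln (real n) * ?k \<le> t * (real k - ?m * p)}
      + measure_pmf.prob ?B {k. 7 * ln (real n) * ?k \<le> - t * (real k - ?m * p)}"
    by (rule measure_subadditive) auto
  also have "\<dots> \<le> (1 / real n ^ 6) ^ card S + (1 / real n ^ 6) ^ card S"
    by (intro add_mono tail) auto
  finally show ?thesis by (simp add: L_def E_def)
qed

lemma sum_power_card_Pow:
  fixes x :: real
  assumes "finite A"
  shows "(\<Sum>S\<in>Pow A. x ^ card S) = (1 + x) ^ card A"
  using prod_add[OF assms, of "\<lambda>_. x" "\<lambda>_. 1"] by (simp add: add.commute)

text \<open>Replacing \<open>p\<close> by the density of \<open>G\<close> costs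
  \<open>4 * L * card S\<close>, in addition to the deviation \<open>L * card S\<close>
  itself.\<close>

lemma homogeneousI:
  assumes n: "n \<ge> 2" and G: "G \<in> graphs n"
    and dev: "\<And>S. S \<subseteq> {1..n} \<Longrightarrow>
      \<bar>real (card (G \<inter> touching S (edges n))) - p * real (card (touching S (edges n)))\<bar> \<le> L * real (card S)"
  shows "G \<in> homogeneous n (5 * L)"
proof -
  define N where "N = real (card (edges n))"
  define d where "d = edge_density n G"
  have Int: "G \<inter> touching S (edges n) = touching S G" for S
    using G by (auto simp: graphs_def touching_def)
  have N: "N \<ge> real n ^ 2 / 4" unfolding N_def by (rule card_edges_ge[OF n])
  moreover have "real n ^ 2 / 4 > 0" using n by simp
  ultimately have Npos: "N > 0" by linarith
  have dN: "d * N = real (card G)" using Npos by (auto simp: d_def edge_density_def N_def)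
  have all: "touching {1..n} (edges n) = edges n"
    by (auto simp: touching_def edges_def Int_absorb2)
  \<comment> \<open>For the full vertex set the deviation hypothesis controls the total edge count,
    and so \<open>d - p\<close>.\<close>
  have "\<bar>real (card (G \<inter> edges n)) - p * N\<bar> \<le> L * real n" using dev[OF order_refl] unfolding all by (simp add: N_def)
  moreover have "G \<inter> edges n = G" using G by (auto simp: graphs_def)
  ultimately have "\<bar>d - p\<bar> * N \<le> L * real n"
    using abs_mult[of "d - p" N] Npos dN by (simp add: left_diff_distrib)
  moreover have "\<bar>d - p\<bar> * (real n ^ 2 / 4) \<le> \<bar>d - p\<bar> * N" using N by (intro mult_left_mono) auto
  ultimately have "\<bar>d - p\<bar> * (real n ^ 2 / 4) \<le> L * real n" by linarith
  then have dp: "\<bar>d - p\<bar> * real n \<le> 4 * L" using n by (simp add: power2_eq_square field_simps)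
  have "\<bar>real (card (avoiding S G)) - d * real (card (avoiding S (edges n)))\<bar> \<le> 5 * L * real (card S)"
    if S: "S \<subseteq> {1..n}" for S
  proof -
    let ?T = "real (card (touching S (edges n)))"
    have "real (card (avoiding S G)) + real (card (touching S G)) = d * N"
      using card_avoiding_touching[OF finite_graph[OF G], of S] dN by linarith
    moreover have "d * N = d * real (card (avoiding S (edges n))) + d * ?T"
      using card_avoiding_touching[of "edges n" S]
      unfolding N_def distrib_left[symmetric] by (simp flip: of_nat_add)
    \<comment> \<open>The density \<open>d\<close> predicts the total count exactly, so the error
      off \<open>S\<close> is the negative of the error on the edges touching
      \<open>S\<close>.\<close>
    ultimately have "real (card (avoiding S G)) - d * real (card (avoiding S (edges n)))
        = (p * ?T - real (card (touching S G))) + (d - p) * ?T"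
      unfolding left_diff_distrib by linarith
    also have "\<bar>\<dots>\<bar> \<le> L * real (card S) + \<bar>d - p\<bar> * ?T"
      using dev[OF S] by (intro order_trans[OF abs_triangle_ineq] add_mono) (auto simp: Int abs_mult abs_minus_commute)
    also have "?T \<le> real (card S) * real n" using card_touching_edges_le[OF S] by (simp flip: of_nat_mult)
    then have "\<bar>d - p\<bar> * ?T \<le> \<bar>d - p\<bar> * (real (card S) * real n)" by (intro mult_left_mono) auto
    also have "\<dots> = (\<bar>d - p\<bar> * real n) * real (card S)" by simp
    also have "\<dots> \<le> 4 * L * real (card S)" using dp by (intro mult_right_mono) auto
    finally show ?thesis by simp
  qed
  then show ?thesis using G by (simp add: homogeneous_def d_def)
qed

text \<open>A union bound over all nonempty \<open>S\<close>. The constant 35 is 7 from the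
  deviation bound times 5 from \<open>homogeneousI\<close>.\<close>

lemma erdos_renyi_homogeneous:
  assumes p: "p \<in> {0..1}" "p \<le> r" and n: "n \<ge> 2" and r: "ln (real n) / real n \<le> r"
  shows "measure_pmf.prob (erdos_renyi n p) (- homogeneous n (35 * sqrt (real n * r * ln (real n))))
    \<le> 4 / real n ^ 5"
proof -
  let ?P = "erdos_renyi n p"
  define L where "L = 7 * sqrt (real n * r * ln (real n))"
  define x where "x = 1 / real n ^ 6"
  define Bad where "Bad S = {G. L * real (card S)
        < \<bar>real (card (G \<inter> touching S (edges n))) - p * real (card (touching S (edges n)))\<bar>}" for S
  have bad: "measure_pmf.prob ?P (Bad S) \<le> 2 * x ^ card S" if "S \<subseteq> {1..n}" for S
    unfolding Bad_def L_def x_def by (rule erdos_renyi_touching_deviation[OF p n r that])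
  have nx: "real n * x = 1 / real n ^ 5" using n power_add[of "real n" 1 5] by (simp add: x_def)
  have nx1: "0 \<le> real n * x" "real n * x \<le> 1" using n by (auto simp: nx)
  have "measure_pmf.prob ?P (- homogeneous n (5 * L))
      \<le> measure_pmf.prob ?P (\<Union>S\<in>Pow {1..n} - {{}}. Bad S)"
  proof (rule measure_pmf.finite_measure_mono_AE, rule AE_pmfI, rule impI)
    fix G assume G: "G \<in> set_pmf ?P" "G \<in> - homogeneous n (5 * L)"
    then have "G \<in> graphs n" using set_erdos_renyi by blast
    have "\<not> (\<forall>S. S \<subseteq> {1..n} \<longrightarrow> G \<notin> Bad S)"
    proof
      assume "\<forall>S. S \<subseteq> {1..n} \<longrightarrow> G \<notin> Bad S"
      then have "G \<in> homogeneous n (5 * L)"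
        by (intro homogeneousI[OF n \<open>G \<in> graphs n\<close>, of p L]) (simp add: Bad_def not_less)
      with G(2) show False by simp
    qed
    then obtain S where "S \<subseteq> {1..n}" "G \<in> Bad S" by blast
    \<comment> \<open>Leaving out the empty set matters: its term in the union bound would be
      2.\<close>
    moreover have "Bad {} = {}" by (simp add: Bad_def touching_def)
    ultimately show "G \<in> (\<Union>S\<in>Pow {1..n} - {{}}. Bad S)" by blast
  qed simp
  also have "\<dots> \<le> (\<Sum>S\<in>Pow {1..n} - {{}}. measure_pmf.prob ?P (Bad S))"
    by (intro measure_pmf.finite_measure_subadditive_finite) auto
  also have "\<dots> \<le> (\<Sum>S\<in>Pow {1..n} - {{}}. 2 * x ^ card S)"
    by (intro sum_mono bad) auto
  also have "\<dots> = 2 * ((1 + x) ^ n - 1)"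
    by (simp add: sum_diff1 sum_distrib_left[symmetric] sum_power_card_Pow)
  also have "\<dots> \<le> 4 * (real n * x)"
  proof -
    have "(1 + x) ^ n \<le> exp x ^ n" by (intro power_mono) (auto simp: x_def)
    also have "\<dots> = exp (real n * x)" by (simp add: exp_of_nat_mult)
    also have "\<dots> \<le> 1 + real n * x + (real n * x)\<^sup>2" using nx1 by (intro exp_le_quadratic) auto
    also have "(real n * x)\<^sup>2 \<le> real n * x" using nx1 by (simp add: power2_eq_square mult_left_le)
    finally have "(1 + x) ^ n \<le> 1 + 2 * (real n * x)" by (simp add: mult.commute)
    then have "2 * ((1 + x) ^ n - 1) \<le> 2 * (2 * (real n * x))"
      by (intro mult_left_mono) (simp_all add: diff_le_eq add.commute)
    then show ?thesis by simp
  qed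
  finally show ?thesis by (simp add: nx L_def)
qed

text \<open>The edge count is binomial with \<open>N\<close> trials, so the variance is
  \<open>p * (1 - p) / N\<close>, where \<open>N \<ge> n^2 / 4\<close>.\<close>

lemma edge_density_variance:
  assumes p: "p \<in> {0..1}" and n: "n \<ge> 2"
  shows "(\<integral>\<^sup>+ G. ennreal ((edge_density n G - p)\<^sup>2) \<partial>measure_pmf (erdos_renyi n p))
    \<le> ennreal (4 * p / real n ^ 2)"
proof -
  define N where "N = card (edges n)"
  have N: "real N \<ge> real n ^ 2 / 4" unfolding N_def by (rule card_edges_ge[OF n])
  have n2: "real n ^ 2 / 4 > 0" using n by simp
  then have Npos: "real N > 0" using N by linarith
  have "(\<integral>\<^sup>+ G. ennreal ((edge_density n G - p)\<^sup>2) \<partial>measure_pmf (erdos_renyi n p))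
      = (\<integral>\<^sup>+ G. ennreal ((real (card (G \<inter> edges n)) - real N * p)\<^sup>2 / real N ^ 2) \<partial>measure_pmf (erdos_renyi n p))"
  proof (intro nn_integral_cong_AE AE_pmfI)
    fix G assume "G \<in> set_pmf (erdos_renyi n p)"
    then have "G \<inter> edges n = G" using set_erdos_renyi by (auto simp: graphs_def)
    then show "ennreal ((edge_density n G - p)\<^sup>2) = ennreal ((real (card (G \<inter> edges n)) - real N * p)\<^sup>2 / real N ^ 2)"
      using Npos by (auto simp: edge_density_def N_def power_divide[symmetric] diff_divide_distrib)
  qed
  also have "\<dots> = (\<integral>\<^sup>+ k. ennreal ((real k - real N * p)\<^sup>2 / real N ^ 2)
      \<partial>measure_pmf (map_pmf (\<lambda>G. card (G \<inter> edges n)) (erdos_renyi n p)))"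
    by simp
  also have "\<dots> = (\<integral>\<^sup>+ k. ennreal ((real k - real N * p)\<^sup>2 / real N ^ 2) \<partial>measure_pmf (binomial_pmf N p))"
    by (simp only: erdos_renyi_card_Int[OF order_refl p] N_def)
  also have "\<dots> = ennreal (measure_pmf.expectation (binomial_pmf N p) (\<lambda>k. (real k - real N * p)\<^sup>2 / real N ^ 2))"
    by (intro nn_integral_eq_integral integrable_measure_pmf_finite finite_set_pmf_binomial_pmf p) auto
  also have "\<dots> = ennreal (real N * p * (1 - p) / real N ^ 2)"
    by (simp add: expectation_binomial_sq_dev[OF p])
  also have "\<dots> \<le> ennreal (4 * p / real n ^ 2)"
  proof (rule ennreal_leI)
    have "real N * p * (1 - p) / real N ^ 2 = p * (1 - p) / real N"
      using Npos by (simp add: power2_eq_square)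
    also have "\<dots> \<le> p / (real n ^ 2 / 4)"
      using p N n2 by (intro frac_le) (auto simp: mult_left_le)
    finally show "real N * p * (1 - p) / real N ^ 2 \<le> 4 * p / real n ^ 2" by (simp add: mult.commute)
  qed
  finally show ?thesis .
qed

section \<open>The risk\<close>

text \<open>Homogeneous graphs contribute the noise \<open>160 * r^2\<close> and twice the variance
  of the density. All others contribute at most 4, with probability at most
  \<open>4 / n^5\<close>.\<close>

lemma mse_mechanism_le:
  assumes n: "n \<ge> 4" and p: "p \<in> {0..1}" and \<epsilon>: "0 < \<epsilon>"
    and \<sigma>: "p \<le> \<sigma>" "ln (real n) / real n \<le> \<sigma>"
    and L: "L = 35 * sqrt (real n * \<sigma> * ln (real n))"
    and r: "r = 32 * L / real n ^ 2 / \<epsilon>" "r \<le> 1" "exp (- \<epsilon> * real n / 4) \<le> r ^ 3"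
  shows "mse n (mechanism n L (32 * L / real n ^ 2) \<epsilon>) p
    \<le> ennreal (160 * r ^ 2 + 8 * p / real n ^ 2 + 16 / real n ^ 5)"
proof -
  let ?P = "erdos_renyi n p" and ?A = "mechanism n L (32 * L / real n ^ 2) \<epsilon>"
  let ?H = "homogeneous n L"
  have "ln (real n) / real n > 0" using n by simp
  then have "\<sigma> > 0" using \<sigma>(2) by linarith
  then have Lpos: "L > 0" using n by (simp add: L)
  have \<eta>: "32 * L / real n ^ 2 > 0" using Lpos n by simp
  have "mse n ?A p \<le> (\<integral>\<^sup>+ G. ennreal (160 * r ^ 2) + (2 * ennreal ((edge_density n G - p)\<^sup>2)
      + 4 * indicator (- ?H) G) \<partial>measure_pmf ?P)"
    unfolding mse_def
  proof (intro nn_integral_mono_AE AE_pmfI)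
    fix G assume "G \<in> set_pmf ?P"
    then have G: "G \<in> graphs n" using set_erdos_renyi by blast
    show "(\<integral>\<^sup>+ x. ennreal ((x - p)\<^sup>2) \<partial>?A G) \<le> ennreal (160 * r ^ 2)
      + (2 * ennreal ((edge_density n G - p)\<^sup>2) + 4 * indicator (- ?H) G)"
    proof (cases "G \<in> ?H")
      case True
      have "2 * ennreal ((edge_density n G - p)\<^sup>2) = ennreal (2 * (edge_density n G - p)\<^sup>2)"
        using ennreal_mult[of 2 "(edge_density n G - p)\<^sup>2"] by simp
      then show ?thesis
        using mechanism_risk_homogeneous[OF Lpos n True \<epsilon> r, of p] True by simp
    next
      case False
      then have "(\<integral>\<^sup>+ x. ennreal ((x - p)\<^sup>2) \<partial>?A G) \<le> 4 * indicator (- ?H) G"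
        using mechanism_risk_le_4[of L _ \<epsilon> G n p] Lpos \<eta> \<epsilon> G p by simp
      then show ?thesis by (intro add_increasing) auto
    qed
  qed
  also have "\<dots> = ennreal (160 * r ^ 2)
      + (2 * (\<integral>\<^sup>+ G. ennreal ((edge_density n G - p)\<^sup>2) \<partial>measure_pmf ?P)
      + 4 * ennreal (measure_pmf.prob ?P (- ?H)))"
    by (simp add: nn_integral_add nn_integral_cmult measure_pmf.emeasure_eq_measure)
  also have "\<dots> \<le> ennreal (160 * r ^ 2) + (2 * ennreal (4 * p / real n ^ 2) + 4 * ennreal (4 / real n ^ 5))"
    using n p \<sigma> unfolding L
    by (intro add_left_mono add_mono mult_left_mono edge_density_variance ennreal_leI erdos_renyi_homogeneous)
      auto
  also have "\<dots> = ennreal (160 * r ^ 2) + (ennreal (8 * p / real n ^ 2) + ennreal (16 / real n ^ 5))"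
    using p ennreal_mult[of 2 "4 * p / real n ^ 2"] ennreal_mult[of 4 "4 / real n ^ 5"] by simp
  also have "\<dots> = ennreal (160 * r ^ 2 + 8 * p / real n ^ 2 + 16 / real n ^ 5)"
    using p by (simp add: add.assoc)
  finally show ?thesis .
qed

lemma rate_le:
  assumes n: "n \<ge> 4" and \<rho>: "\<rho> \<in> {0..1}" and \<epsilon>: "\<epsilon> \<in> {0<..<1}"
    and ln: "1 \<le> ln (real n)" and priv: "1200 * ln (real n) \<le> \<epsilon> * real n"
  shows "rate \<rho> \<epsilon> n \<le> ennreal (200704016 * (\<rho> / real n ^ 2
      + max \<rho> (ln (real n) / real n) * (ln (real n) / (real n ^ 3 * \<epsilon> ^ 2))))"
proof -
  \<comment> \<open>An upper bound for every admissible \<open>p\<close>. Thus \<open>L\<close>, and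
    with it the mechanism, is chosen without knowledge of \<open>p\<close>.\<close>
  define \<sigma> where "\<sigma> = max \<rho> (ln (real n) / real n)"
  define L where "L = 35 * sqrt (real n * \<sigma> * ln (real n))"
  define r where "r = 32 * L / real n ^ 2 / \<epsilon>"
  define T where "T = \<sigma> * (ln (real n) / (real n ^ 3 * \<epsilon> ^ 2))"
  have npos: "real n > 0" and e: "0 < \<epsilon>" "\<epsilon> < 1" using n \<epsilon> by auto
  have lnn: "ln (real n) \<le> real n" using ln_le_minus_one[OF npos] by simp
  have ln0: "0 < ln (real n) / real n" using ln n by (intro divide_pos_pos) auto
  have \<sigma>: "\<rho> \<le> \<sigma>" "ln (real n) / real n \<le> \<sigma>" "\<sigma> \<le> 1" "0 < \<sigma>"
    using \<rho> npos ln0 lnn by (auto simp: \<sigma>_def less_max_iff_disj)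
  have \<sigma>n: "ln (real n) \<le> real n * \<sigma>" using \<sigma>(2) npos by (simp add: field_simps)
  \<comment> \<open>The constant is \<open>(32 * 35)^2\<close>.\<close>
  have "r\<^sup>2 = 1254400 * (real n * \<sigma> * ln (real n)) / (real n ^ 4 * \<epsilon>\<^sup>2)"
    using \<sigma>(4) ln by (simp add: r_def L_def power_divide power_mult_distrib)
  also have "\<dots> = 1254400 * T"
    using npos e by (simp add: T_def field_simps eval_nat_numeral)
  finally have r2: "r\<^sup>2 = 1254400 * T" .
  have T_upper: "1254400 * T \<le> 1"
  proof -
    \<comment> \<open>The threshold 1200 is large enough because its square exceeds 1254400.\<close>
    have "1440000 * (ln (real n))\<^sup>2 = (1200 * ln (real n))\<^sup>2" by (simp add: power_mult_distrib)
    also have "\<dots> \<le> (\<epsilon> * real n)\<^sup>2" using priv ln by (intro power_mono) auto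
    finally have 1: "1440000 * (ln (real n))\<^sup>2 \<le> (\<epsilon> * real n)\<^sup>2" .
    have "\<sigma> * ln (real n) \<le> (ln (real n))\<^sup>2"
      using \<sigma> ln by (simp add: power2_eq_square mult_right_mono)
    also have "\<dots> \<le> (ln (real n))\<^sup>2 * real n" using npos n by simp
    finally have "1254400 * (\<sigma> * ln (real n)) \<le> 1440000 * ((ln (real n))\<^sup>2 * real n)"
      using mult_mono[of 1254400 1440000 "\<sigma> * ln (real n)" "(ln (real n))\<^sup>2 * real n"] \<sigma> ln
      by simp
    also have "\<dots> \<le> (\<epsilon> * real n)\<^sup>2 * real n" using mult_right_mono[OF 1, of "real n"] by simp
    also have "\<dots> = real n ^ 3 * \<epsilon>\<^sup>2" by (simp add: power2_eq_square power3_eq_cube)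
    finally show ?thesis using npos e by (simp add: T_def field_simps)
  qed
  \<comment> \<open>Lets \<open>T\<close> absorb the contribution \<open>16 / n^5\<close> of the
    graphs that are not homogeneous.\<close>
  have T_lower: "1 / real n ^ 5 \<le> T"
  proof -
    have "1 / real n ^ 5 \<le> (1 / real n) * (1 / (real n ^ 3 * 1))"
      using n by (simp add: field_simps eval_nat_numeral)
    also have "\<dots> \<le> T" unfolding T_def
    proof (rule mult_mono)
      show "1 / real n \<le> \<sigma>" using \<sigma>(2) ln npos by (simp add: field_simps)
      have "real n ^ 3 * \<epsilon>\<^sup>2 \<le> real n ^ 3 * 1"
        using e by (intro mult_left_mono) (auto simp: power_le_one)
      then show "1 / (real n ^ 3 * 1) \<le> ln (real n) / (real n ^ 3 * \<epsilon>\<^sup>2)"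
        using npos e ln by (intro frac_le) auto
    qed (use npos e ln \<sigma> in auto)
    finally show ?thesis .
  qed
  have "1 \<le> sqrt (real n * \<sigma> * ln (real n))"
    using mult_mono[of 1 "real n * \<sigma>" 1 "ln (real n)"] \<sigma>n ln by simp
  then have L1: "1 \<le> 32 * L" and Lpos: "L > 0" unfolding L_def by linarith+
  from Lpos have rpos: "r > 0" using npos e by (simp add: r_def)
  have r1: "r \<le> 1" using T_upper r2 by (simp add: power2_le_imp_le[of r 1])
  have r_lower: "1 / real n ^ 2 \<le> r"
  proof -
    have "1 / real n ^ 2 / 1 \<le> 32 * L / real n ^ 2 / \<epsilon>"
      using e npos L1 by (intro frac_le divide_right_mono) auto
    then show ?thesis by (simp add: r_def)
  qed
  \<comment> \<open>The exponent is in fact at most \<open>- 300 * ln n\<close>; a factor 6 is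
    enough, since \<open>r^3\<close> is at least \<open>1 / n^6\<close>.\<close>
  have "exp (- \<epsilon> * real n / 4) \<le> exp (- (6 * ln (real n)))" using priv ln by simp
  also have "\<dots> = (1 / real n ^ 2) ^ 3"
    using npos exp_of_nat_mult[of 6 "ln (real n)"] by (simp add: exp_minus field_simps flip: power_mult)
  also have "\<dots> \<le> r ^ 3" using r_lower by (intro power_mono) auto
  finally have tail: "exp (- \<epsilon> * real n / 4) \<le> r ^ 3" .
  let ?A = "mechanism n L (32 * L / real n ^ 2) \<epsilon>"
  have "node_dp n \<epsilon> ?A"
    using npos e Lpos by (intro node_dp_mechanism) auto
  then have "rate \<rho> \<epsilon> n \<le> (SUP p\<in>{0..\<rho>}. mse n ?A p)"
    unfolding rate_def by (intro INF_lower) simp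
  also have "\<dots> \<le> ennreal (200704016 * (\<rho> / real n ^ 2 + T))"
  proof (rule SUP_least)
    fix p assume p: "p \<in> {0..\<rho>}"
    then have p1: "p \<in> {0..1}" "p \<le> \<sigma>" using \<rho> \<sigma> by auto
    have "mse n ?A p \<le> ennreal (160 * r ^ 2 + 8 * p / real n ^ 2 + 16 / real n ^ 5)"
      by (rule mse_mechanism_le[OF n p1(1) e(1) p1(2) \<sigma>(2) L_def r_def r1 tail])
    also have "\<dots> \<le> ennreal (200704016 * (\<rho> / real n ^ 2 + T))"
    proof (rule ennreal_leI)
      \<comment> \<open>The final constant is \<open>160 * 1254400 + 16\<close>; it also dominates
        the factor 8 of the variance term.\<close>
      have "p / real n ^ 2 \<le> \<rho> / real n ^ 2" "0 \<le> \<rho> / real n ^ 2"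
        using p \<rho> by (auto intro: divide_right_mono)
      then show "160 * r ^ 2 + 8 * p / real n ^ 2 + 16 / real n ^ 5 \<le> 200704016 * (\<rho> / real n ^ 2 + T)"
        using T_lower unfolding r2 times_divide_eq_right[symmetric]
        by (simp only: distrib_left)
    qed
    finally show "mse n ?A p \<le> ennreal (200704016 * (\<rho> / real n ^ 2 + T))" .
  qed
  finally show ?thesis unfolding T_def \<sigma>_def .
qed

theorem theorem4p3:
  fixes \<rho> \<epsilon> :: "nat \<Rightarrow> real"
  assumes "\<And>n. \<rho> n \<in> {0..1}"
    and "\<And>n. \<epsilon> n \<in> {0<..<1}"
    and "filterlim (\<lambda>n. \<epsilon> n * real n / ln (real n)) at_top sequentially"
  shows "\<exists>C>0. \<forall>\<^sub>F n in sequentially.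
    rate (\<rho> n) (\<epsilon> n) n \<le>
      ennreal (C * (\<rho> n / real n ^ 2
        + max (\<rho> n) (ln (real n) / real n) * (ln (real n) / (real n ^ 3 * \<epsilon> n ^ 2))))"
proof (intro exI[of _ 200704016] conjI)
  \<comment> \<open>Divergence of the ratio is used through the explicit threshold in
    \<open>rate_le\<close>.\<close>
  have "\<forall>\<^sub>F n in sequentially. 1200 \<le> \<epsilon> n * real n / ln (real n)"
    using assms(3) by (simp add: filterlim_at_top)
  moreover have "\<forall>\<^sub>F n in sequentially. (4::nat) \<le> n" by (rule eventually_ge_at_top)
  ultimately show "\<forall>\<^sub>F n in sequentially. rate (\<rho> n) (\<epsilon> n) n \<le>
      ennreal (200704016 * (\<rho> n / real n ^ 2
        + max (\<rho> n) (ln (real n) / real n) * (ln (real n) / (real n ^ 3 * \<epsilon> n ^ 2))))"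
  proof eventually_elim
    case (elim n)
    \<comment> \<open>Since \<open>exp 1 \<le> 3\<close>, already \<open>n \<ge> 4\<close> gives
      \<open>ln n \<ge> 1\<close>.\<close>
    have "exp 1 \<le> real n" using exp_le elim(2) by linarith
    then have "1 \<le> ln (real n)" using elim(2) by (subst ln_ge_iff) auto
    then show ?case
      using elim by (intro rate_le assms) (auto simp: field_simps)
  qed
qed simp

end
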